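(* Let $\mathcal{F}$ be a family of subsets of $\mathbb{Z}^n$ and let $\phi:\mathbb{Z}^n\to\mathbb{Z}^t$ be a linear map. Let $\succeq$ and $\succeq'$ be additive preorders on $\mathbb{Z}^n$ and $\mathbb{Z}^t$, respectively, that are compatible with $\phi$ and $\mathcal{F}$. Let $\mathcal{G}\subseteq\mathbb{Z}^t$ be a projected fiber Gröbner basis (a $\succeq'$-Gröbner basis of $\phi(\mathcal{F})$), let $\mathcal{M}_1\subseteq\mathbb{Z}^n$ be an $(\mathcal{F},\phi,\succeq)$-lift of $\mathcal{G}$, and let $\mathcal{M}_0\subseteq\mathbb{Z}^n$ be a kernel Gröbner basis. Then $\mathcal{M}_0\cup\mathcal{M}_1$ is a $\succeq$-Gröbner basis of $\mathcal{F}$.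
   Context: An additive preorder on $\mathbb{Z}^n$ is a reflexive, transitive relation $\succeq$ such that any two elements are comparable and $u\succeq v$ implies $u+w\succeq v+w$ for all $w$. For $F\subseteq\mathbb{Z}^n$, $\mathcal{M}\subseteq\mathbb{Z}^n$ and an additive preorder $\succeq$, let $F_{\mathcal{M},\succeq}$ be the directed graph with vertex set $F$ and an edge $u\to v$ iff $v-u\in\pm\mathcal{M}$ and $u\succeq v$. Let $u\sim v$ if there are directed paths from $u$ to $v$ and from $v$ to $u$; $F_{\mathcal{M},\succeq}/{\sim}$ is the quotient directed graph (without directed cycles). For a collection $\mathcal{F}$ of subsets of $\mathbb{Z}^n$, $\mathcal{M}$ is a $\succeq$-Gröbner basis of $\mathcal{F}$ if for every $F\in\mathcal{F}$: (1) $F_{\mathcal{M},\succeq}$ is weakly connected (the underlying undirected graph is connected); (2) $F_{\mathcal{M},\succeq}/{\sim}$ has at most one sink; (3) each sink of $F_{\mathcal{M},\succeq}/{\sim}$ is a $\succeq$-minimum of $F$ (its elements $u$ satisfy $w\succeq u$ for all $w\in F$). $\phi(\mathcal{F})=\{\phi(F):F\in\mathcal{F}\}$. The preorders $\succeq$ (on $\mathbb{Z}^n$) and $\succeq'$ (on $\mathbb{Z}^t$) are compatible with $\phi$ and $\mathcal{F}$ if for all $F\in\mathcal{F}$ and $u,v\in F$ with $\phi(u)\ne\phi(v)$: $\phi(u)\succeq'\phi(v)$ if and only if $u\succeq v$. A kernel Gröbner basis is a $\succeq$-Gröbner basis of the family of all sets $F\cap(u+\ker_{\mathbb{Z}}\phi)$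 with $F\in\mathcal{F}$, $u\in\mathbb{Z}^n$. An $(\mathcal{F},\phi,\succeq)$-lift of $\mathcal{G}\subseteq\mathbb{Z}^t$ is a set $\mathcal{M}\subseteq\mathbb{Z}^n$ such that for all $F\in\mathcal{F}$ and all $v,v'\in F$ with $v\succeq v'$ and $\phi(v-v')\in\pm\mathcal{G}$ there are $m_0\in\ker_{\mathbb{Z}}\phi$ and $m\in\pm\mathcal{M}$ such that $v+m_0\in F$, $v+m_0+m\in F$, $v\succeq v+m_0\succeq v+m_0+m$, and $\phi(v+m_0+m)=\phi(v')$. *)

theory Defs
  imports "HOL-Analysis.Cartesian_Space"
begin

definition additive_preorder :: "('a::ab_group_add \<Rightarrow> 'a \<Rightarrow> bool) \<Rightarrow> bool" where
  "additive_preorder geq \<longleftrightarrow>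
     reflp geq \<and> transp geq \<and> totalp geq \<and>
     (\<forall>u v w. geq u v \<longrightarrow> geq (u + w) (v + w))"

definition pm :: "'a::ab_group_add set \<Rightarrow> 'a set" where
  "pm M = M \<union> uminus ` M"

text \<open>A directed graph is a vertex set \<open>V\<close> together with an arc set \<open>E \<subseteq> V \<times> V\<close>.\<close>

definition fiber_arcs ::
    "'a::ab_group_add set \<Rightarrow> 'a set \<Rightarrow> ('a \<Rightarrow> 'a \<Rightarrow> bool) \<Rightarrow> ('a \<times> 'a) set" where
  "fiber_arcs F M geq = {(u, v). u \<in> F \<and> v \<in> F \<and> v - u \<in> pm M \<and> geq u v}"

text \<open>The empty graph counts as weakly connected. This matters: the family of kernel fibers
  below usually contains the empty set, so kernel Groebner bases would otherwise hardly ever exist.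
  For the same reason the notion of connectedness of the entry Graph_Theory, which excludes
  the empty graph, is not used.\<close>

definition weakly_connected :: "'a set \<Rightarrow> ('a \<times> 'a) set \<Rightarrow> bool" where
  "weakly_connected V E \<longleftrightarrow> (\<forall>u\<in>V. \<forall>v\<in>V. (u, v) \<in> (E \<union> E\<inverse>)\<^sup>*)"

definition sinks :: "'a set \<Rightarrow> ('a \<times> 'a) set \<Rightarrow> 'a set" where
  "sinks V E = {x \<in> V. \<forall>y. (x, y) \<notin> E}"

definition mutually_reachable :: "'a set \<Rightarrow> ('a \<times> 'a) set \<Rightarrow> ('a \<times> 'a) set" where
  "mutually_reachable V E = {(u, v). u \<in> V \<and> v \<in> V \<and> (u, v) \<in> E\<^sup>* \<and> (v, u) \<in> E\<^sup>*}"

definition quotient_verts :: "'a set \<Rightarrow> ('a \<times> 'a) set \<Rightarrow> 'a set set" where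
  "quotient_verts V E = V // mutually_reachable V E"

text \<open>Arcs inside a class are dropped, so that the quotient graph has no loops.\<close>

definition quotient_arcs :: "'a set \<Rightarrow> ('a \<times> 'a) set \<Rightarrow> ('a set \<times> 'a set) set" where
  "quotient_arcs V E =
     {(A, B). A \<in> quotient_verts V E \<and> B \<in> quotient_verts V E \<and> A \<noteq> B \<and>
              (\<exists>u\<in>A. \<exists>v\<in>B. (u, v) \<in> E)}"

definition quotient_sinks :: "'a set \<Rightarrow> ('a \<times> 'a) set \<Rightarrow> 'a set set" where
  "quotient_sinks V E = sinks (quotient_verts V E) (quotient_arcs V E)"

definition groebner_basis ::
    "('a::ab_group_add \<Rightarrow> 'a \<Rightarrow> bool) \<Rightarrow> 'a set set \<Rightarrow> 'a set \<Rightarrow> bool" where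
  "groebner_basis geq \<F> M \<longleftrightarrow>
     (\<forall>F\<in>\<F>.
        weakly_connected F (fiber_arcs F M geq) \<and>
        (\<forall>A\<in>quotient_sinks F (fiber_arcs F M geq).
          \<forall>B\<in>quotient_sinks F (fiber_arcs F M geq). A = B) \<and>
        (\<forall>A\<in>quotient_sinks F (fiber_arcs F M geq). \<forall>u\<in>A. \<forall>w\<in>F. geq w u))"

definition compatible_preorders ::
    "('a \<Rightarrow> 'a \<Rightarrow> bool) \<Rightarrow> ('b \<Rightarrow> 'b \<Rightarrow> bool) \<Rightarrow> ('a \<Rightarrow> 'b) \<Rightarrow> 'a set set \<Rightarrow> bool" where
  "compatible_preorders geq geq' \<phi> \<F> \<longleftrightarrow>
     (\<forall>F\<in>\<F>. \<forall>u\<in>F. \<forall>v\<in>F. \<phi> u \<noteq> \<phi> v \<longrightarrow> (geq' (\<phi> u) (\<phi> v) \<longleftrightarrow> geq u v))"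

definition ker :: "('a \<Rightarrow> 'b::zero) \<Rightarrow> 'a set" where
  "ker \<phi> = {m. \<phi> m = 0}"

definition kernel_fibers ::
    "('a::ab_group_add \<Rightarrow> 'b::ab_group_add) \<Rightarrow> 'a set set \<Rightarrow> 'a set set" where
  "kernel_fibers \<phi> \<F> = {F \<inter> (\<lambda>m. u + m) ` ker \<phi> | F u. F \<in> \<F>}"

definition kernel_groebner_basis ::
    "('a::ab_group_add \<Rightarrow> 'a \<Rightarrow> bool) \<Rightarrow> ('a \<Rightarrow> 'b::ab_group_add) \<Rightarrow> 'a set set \<Rightarrow> 'a set \<Rightarrow> bool" where
  "kernel_groebner_basis geq \<phi> \<F> M \<longleftrightarrow> groebner_basis geq (kernel_fibers \<phi> \<F>) M"

definition projected_fiber_groebner_basis ::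
    "('b::ab_group_add \<Rightarrow> 'b \<Rightarrow> bool) \<Rightarrow> ('a \<Rightarrow> 'b) \<Rightarrow> 'a set set \<Rightarrow> 'b set \<Rightarrow> bool" where
  "projected_fiber_groebner_basis geq' \<phi> \<F> G \<longleftrightarrow> groebner_basis geq' ((\<lambda>F. \<phi> ` F) ` \<F>) G"

definition is_lift ::
    "'a set set \<Rightarrow> ('a::ab_group_add \<Rightarrow> 'b::ab_group_add) \<Rightarrow> ('a \<Rightarrow> 'a \<Rightarrow> bool) \<Rightarrow>
     'b set \<Rightarrow> 'a set \<Rightarrow> bool" where
  "is_lift \<F> \<phi> geq G M \<longleftrightarrow>
     (\<forall>F\<in>\<F>. \<forall>v\<in>F. \<forall>v'\<in>F. geq v v' \<longrightarrow> \<phi> (v - v') \<in> pm G \<longrightarrow>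
        (\<exists>m\<^sub>0\<in>ker \<phi>. \<exists>m\<in>pm M.
           v + m\<^sub>0 \<in> F \<and> v + m\<^sub>0 + m \<in> F \<and>
           geq v (v + m\<^sub>0) \<and> geq (v + m\<^sub>0) (v + m\<^sub>0 + m) \<and>
           \<phi> (v + m\<^sub>0 + m) = \<phi> v'))"

end

theory Submission
  imports Defs
begin

text \<open>
  The condensation disappears from the argument once a sink of it is read as the class of a
  \<^emph>\<open>recurrent\<close> vertex, one that can be reached back from whatever it reaches
  (\<open>quotient_sinks_eq\<close>). An arc between two elements that the preorder does not separate can
  also be traversed backwards, because \<open>pm M\<close> is symmetric. Hence a vertex is recurrent iff no
  directed path from it descends strictly (\<open>recurrent_iff\<close>), and a Groebner basis says: the graph is
  connected, recurrent vertices reach each other, and they are minima (\<open>groebner_basis_iff\<close>).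

  Let \<open>x\<close> be recurrent in \<open>F\<close> for \<open>M\<^sub>0 \<union> M\<^sub>1\<close>. It is then recurrent, hence minimal, in its own kernel
  fibre. The main point is that paths starting at \<open>\<phi> x\<close> lift to paths starting at \<open>x\<close>
  (\<open>image_path_lifts\<close>). The lift property turns an arc of the image into a kernel move
  \<open>x \<rightarrow> x + m\<^sub>0\<close>, weakly downwards, followed by an arc in direction \<open>m\<close>. As \<open>x\<close> is minimal in its
  kernel fibre, so is \<open>x + m\<^sub>0\<close>; both are therefore recurrent there, and the kernel Groebner basis
  connects them by a directed path.

  By lifting, nothing strictly below \<open>\<phi> x\<close> is reachable from it, so \<open>\<phi> x\<close> is recurrent and
  hence a minimum of \<open>\<phi> ` F\<close>. Compatibility transports this back to \<open>F\<close> outside the kernel fibre of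
  \<open>x\<close>, and within it \<open>x\<close> is minimal already. For two recurrent vertices \<open>x\<close> and \<open>z\<close>, a path from
  \<open>\<phi> x\<close> to \<open>\<phi> z\<close> lifts to one that ends in the kernel fibre of \<open>z\<close>, at a recurrent vertex, and the
  kernel Groebner basis completes it to \<open>z\<close>. Weak connectedness uses the same lifting of single
  arcs, but there each kernel fibre need only be connected.
\<close>

section \<open>Sinks of the condensation as recurrent vertices\<close>

definition recurrent :: "('a \<times> 'a) set \<Rightarrow> 'a \<Rightarrow> bool" where
  "recurrent E x \<longleftrightarrow> (\<forall>y. (x, y) \<in> E\<^sup>* \<longrightarrow> (y, x) \<in> E\<^sup>*)"

lemma recurrent_reachable:
  assumes "recurrent E x" and "(x, y) \<in> E\<^sup>*"
  shows "recurrent E y"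
  using assms unfolding recurrent_def by (meson rtrancl_trans)

lemma reachable_in_vertices:
  assumes "E \<subseteq> V \<times> V" and "x \<in> V" and "(x, y) \<in> E\<^sup>*"
  shows "y \<in> V"
  using assms(3,2) by (induction rule: rtrancl_induct) (use assms(1) in auto)

lemma equiv_mutually_reachable: "equiv V (mutually_reachable V E)"
  unfolding mutually_reachable_def
  by (rule equivI) (auto simp: refl_on_def sym_def trans_def)

text \<open>A path that starts in a sink class cannot leave it, since its first arc out of the class
  would be an arc of the quotient; conversely, an arc from the class of a recurrent vertex ends at
  a vertex that reaches back, hence in the same class.\<close>

lemma quotient_sinks_eq:
  assumes E: "E \<subseteq> V \<times> V"
  shows "quotient_sinks V E = {mutually_reachable V E `` {x} | x. x \<in> V \<and> recurrent E x}"
proof (intro equalityI subsetI)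
  fix A assume "A \<in> quotient_sinks V E"
  then have A: "A \<in> V // mutually_reachable V E" and sink: "\<And>B. (A, B) \<notin> quotient_arcs V E"
    by (auto simp: quotient_sinks_def sinks_def quotient_verts_def)
  from A obtain x where x: "x \<in> V" and Ax: "A = mutually_reachable V E `` {x}"
    by (rule quotientE)
  have "(y, x) \<in> E\<^sup>*" if "(x, y) \<in> E\<^sup>*" for y
    using that
  proof (induction rule: rtrancl_induct)
    case base
    show ?case by simp
  next
    case (step y z)
    define B where "B = mutually_reachable V E `` {z}"
    have yz: "y \<in> V" "z \<in> V" using E step.hyps(2) by auto
    have "y \<in> A" using x yz step unfolding Ax mutually_reachable_def by simp
    moreover have zB: "z \<in> B" using yz unfolding B_def mutually_reachable_def by simp
    moreover have "B \<in> V // mutually_reachable V E"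
      using yz unfolding B_def by (intro quotientI)
    ultimately have "A = B"
      using sink[of B] A step.hyps(2) unfolding quotient_arcs_def quotient_verts_def by auto
    then have "z \<in> A" using zB by simp
    then show ?case unfolding Ax mutually_reachable_def by simp
  qed
  then show "A \<in> {mutually_reachable V E `` {x} | x. x \<in> V \<and> recurrent E x}"
    using x Ax unfolding recurrent_def by blast
next
  fix A assume "A \<in> {mutually_reachable V E `` {x} | x. x \<in> V \<and> recurrent E x}"
  then obtain x where x: "x \<in> V" "recurrent E x" and Ax: "A = mutually_reachable V E `` {x}"
    by blast
  have A: "A \<in> V // mutually_reachable V E" using x(1) unfolding Ax by (intro quotientI)
  have "(A, B) \<notin> quotient_arcs V E" for B
  proof
    assume "(A, B) \<in> quotient_arcs V E"
    then obtain u v where B: "B \<in> V // mutually_reachable V E" and ne: "A \<noteq> B"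
      and u: "u \<in> A" and v: "v \<in> B" and uv: "(u, v) \<in> E"
      unfolding quotient_arcs_def quotient_verts_def by auto
    have "(x, v) \<in> E\<^sup>*"
      using u uv unfolding Ax mutually_reachable_def by auto
    then have "v \<in> A"
      using x uv E unfolding Ax mutually_reachable_def recurrent_def by auto
    then show False
      using quotient_disj[OF equiv_mutually_reachable A B] v ne by blast
  qed
  then show "A \<in> quotient_sinks V E"
    using A by (simp add: quotient_sinks_def sinks_def quotient_verts_def)
qed

section \<open>Recurrent vertices of fibre graphs\<close>

lemma pm_uminus: "x \<in> pm M \<Longrightarrow> - x \<in> pm M"
  unfolding pm_def by auto

lemma pm_diff_swap: "a - b \<in> pm M \<Longrightarrow> b - a \<in> pm M"
  using pm_uminus[of "a - b" M] by simp

lemma fiber_arcs_subset: "fiber_arcs F M geq \<subseteq> F \<times> F"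
  unfolding fiber_arcs_def by auto

lemma fiber_arcs_mono:
  assumes "F \<subseteq> F'" and "M \<subseteq> M'"
  shows "fiber_arcs F M geq \<subseteq> fiber_arcs F' M' geq"
  using assms unfolding fiber_arcs_def pm_def by auto

lemma additive_preorder_refl: "additive_preorder geq \<Longrightarrow> geq x x"
  unfolding additive_preorder_def by (meson reflpD)

lemma additive_preorder_trans: "additive_preorder geq \<Longrightarrow> geq x y \<Longrightarrow> geq y z \<Longrightarrow> geq x z"
  unfolding additive_preorder_def by (meson transpD)

lemma reachable_imp_geq:
  assumes geq: "additive_preorder geq" and path: "(x, y) \<in> (fiber_arcs F M geq)\<^sup>*"
  shows "geq x y"
  using path
proof (induction rule: rtrancl_induct)
  case base
  show ?case by (rule additive_preorder_refl[OF geq])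
next
  case (step y z)
  then have "geq y z" by (simp add: fiber_arcs_def)
  then show ?case by (rule additive_preorder_trans[OF geq step.IH])
qed

text \<open>A path that never descends strictly can be traversed backwards, as each of its arcs joins
  equivalent elements and \<open>pm M\<close> is symmetric.\<close>

lemma recurrent_iff:
  assumes geq: "additive_preorder geq"
  shows "recurrent (fiber_arcs F M geq) x \<longleftrightarrow>
    (\<forall>y. (x, y) \<in> (fiber_arcs F M geq)\<^sup>* \<longrightarrow> geq y x)" (is "?L \<longleftrightarrow> ?R")
proof
  assume ?L
  then show ?R unfolding recurrent_def using reachable_imp_geq[OF geq] by blast
next
  let ?E = "fiber_arcs F M geq"
  assume R: ?R
  have "(y, x) \<in> ?E\<^sup>*" if "(x, y) \<in> ?E\<^sup>*" for y
    using that
  proof (induction rule: rtrancl_induct)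
    case base
    show ?case by simp
  next
    case (step y z)
    have "geq z x" using R step.hyps by (meson rtrancl.rtrancl_into_rtrancl)
    moreover have "geq x y" using reachable_imp_geq[OF geq step.hyps(1)] .
    ultimately have "geq z y" by (rule additive_preorder_trans[OF geq])
    then have "(z, y) \<in> ?E" using step.hyps(2) by (auto simp: fiber_arcs_def intro: pm_diff_swap)
    then show ?case using step.IH by (rule converse_rtrancl_into_rtrancl)
  qed
  then show ?L unfolding recurrent_def by blast
qed

lemma minimum_imp_recurrent:
  assumes "additive_preorder geq" and "x \<in> F" and "\<And>w. w \<in> F \<Longrightarrow> geq w x"
  shows "recurrent (fiber_arcs F M geq) x"
  unfolding recurrent_iff[OF assms(1)]
  using assms(3) reachable_in_vertices[OF fiber_arcs_subset assms(2)] by blast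

lemma groebner_basis_iff:
  fixes \<F> :: "'a::ab_group_add set set"
  shows "groebner_basis geq \<F> M \<longleftrightarrow> (\<forall>F\<in>\<F>.
     weakly_connected F (fiber_arcs F M geq) \<and>
     (\<forall>x\<in>F. \<forall>y\<in>F. recurrent (fiber_arcs F M geq) x \<longrightarrow> recurrent (fiber_arcs F M geq) y \<longrightarrow>
        (x, y) \<in> (fiber_arcs F M geq)\<^sup>*) \<and>
     (\<forall>x\<in>F. recurrent (fiber_arcs F M geq) x \<longrightarrow> (\<forall>w\<in>F. geq w x)))"
proof -
  have unique: "(\<forall>A\<in>quotient_sinks F E. \<forall>B\<in>quotient_sinks F E. A = B) \<longleftrightarrow>
      (\<forall>x\<in>F. \<forall>y\<in>F. recurrent E x \<longrightarrow> recurrent E y \<longrightarrow> (x, y) \<in> E\<^sup>*)" (is "?L \<longleftrightarrow> ?R")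
    if E: "E \<subseteq> F \<times> F" for F :: "'a set" and E
  proof
    assume L: ?L
    show ?R
    proof (intro ballI impI)
      fix x y
      assume xy: "x \<in> F" "y \<in> F" "recurrent E x" "recurrent E y"
      have "mutually_reachable F E `` {x} \<in> quotient_sinks F E"
        "mutually_reachable F E `` {y} \<in> quotient_sinks F E"
        using xy unfolding quotient_sinks_eq[OF E] by blast+
      with L have "mutually_reachable F E `` {x} = mutually_reachable F E `` {y}" by simp
      then have "(x, y) \<in> mutually_reachable F E"
        using xy(2) by (rule eq_equiv_class[OF _ equiv_mutually_reachable])
      then show "(x, y) \<in> E\<^sup>*" by (simp add: mutually_reachable_def)
    qed
  next
    assume R: ?R
    show ?L
    proof (intro ballI)
      fix A B assume "A \<in> quotient_sinks F E" "B \<in> quotient_sinks F E"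
      then obtain x y where A: "A = mutually_reachable F E `` {x}" "x \<in> F" "recurrent E x"
        and B: "B = mutually_reachable F E `` {y}" "y \<in> F" "recurrent E y"
        unfolding quotient_sinks_eq[OF E] by blast
      have "(x, y) \<in> mutually_reachable F E"
        using A B R by (simp add: mutually_reachable_def)
      then show "A = B"
        unfolding A B by (rule equiv_class_eq[OF equiv_mutually_reachable])
    qed
  qed
  have minimum: "(\<forall>A\<in>quotient_sinks F E. \<forall>u\<in>A. \<forall>w\<in>F. geq w u) \<longleftrightarrow>
      (\<forall>x\<in>F. recurrent E x \<longrightarrow> (\<forall>w\<in>F. geq w x))" (is "?L \<longleftrightarrow> ?R")
    if E: "E \<subseteq> F \<times> F" for F :: "'a set" and E
  proof
    assume L: ?L
    show ?R
    proof (intro ballI impI)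
      fix x w assume x: "x \<in> F" "recurrent E x" and w: "w \<in> F"
      have "x \<in> mutually_reachable F E `` {x}"
        using x by (simp add: mutually_reachable_def)
      moreover have "mutually_reachable F E `` {x} \<in> quotient_sinks F E"
        using x unfolding quotient_sinks_eq[OF E] by blast
      ultimately show "geq w x" using L w by blast
    qed
  next
    assume R: ?R
    show ?L
    proof (intro ballI)
      fix A u w assume "A \<in> quotient_sinks F E" and u: "u \<in> A" and w: "w \<in> F"
      then obtain x where A: "A = mutually_reachable F E `` {x}" and x: "recurrent E x"
        unfolding quotient_sinks_eq[OF E] by blast
      have "u \<in> F" "(x, u) \<in> E\<^sup>*" using u unfolding A by (auto simp: mutually_reachable_def)
      then show "geq w u" using R w recurrent_reachable[OF x] by blast
    qed
  qed
  show ?thesis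
    unfolding groebner_basis_def
    by (simp only: unique[OF fiber_arcs_subset] minimum[OF fiber_arcs_subset])
qed

section \<open>Lifting arcs from the projected fibre\<close>

locale compatible_lift = additive \<phi>
  for \<phi> :: "'a::ab_group_add \<Rightarrow> 'b::ab_group_add" +
  fixes \<F> :: "'a set set" and geq :: "'a \<Rightarrow> 'a \<Rightarrow> bool" and geq' :: "'b \<Rightarrow> 'b \<Rightarrow> bool"
    and G :: "'b set" and M\<^sub>0 M\<^sub>1 :: "'a set"
  assumes geq: "additive_preorder geq"
    and geq': "additive_preorder geq'"
    and compatible: "compatible_preorders geq geq' \<phi> \<F>"
    and projected: "projected_fiber_groebner_basis geq' \<phi> \<F> G"
    and lift: "is_lift \<F> \<phi> geq G M\<^sub>1"
    and kernel: "kernel_groebner_basis geq \<phi> \<F> M\<^sub>0"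
begin

abbreviation arcs :: "'a set \<Rightarrow> ('a \<times> 'a) set" where
  "arcs F \<equiv> fiber_arcs F (M\<^sub>0 \<union> M\<^sub>1) geq"

abbreviation image_arcs :: "'a set \<Rightarrow> ('b \<times> 'b) set" where
  "image_arcs F \<equiv> fiber_arcs (\<phi> ` F) G geq'"

abbreviation kernel_fiber :: "'a set \<Rightarrow> 'a \<Rightarrow> 'a set" where
  "kernel_fiber F u \<equiv> {v \<in> F. \<phi> v = \<phi> u}"

abbreviation kernel_arcs :: "'a set \<Rightarrow> 'a \<Rightarrow> ('a \<times> 'a) set" where
  "kernel_arcs F u \<equiv> fiber_arcs (kernel_fiber F u) M\<^sub>0 geq"

lemma compatibleD:
  assumes "F \<in> \<F>" "u \<in> F" "v \<in> F" "\<phi> u \<noteq> \<phi> v"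
  shows "geq' (\<phi> u) (\<phi> v) \<longleftrightarrow> geq u v"
  using compatible assms unfolding compatible_preorders_def by blast

lemma kernel_fiber_in_kernel_fibers:
  assumes "F \<in> \<F>"
  shows "kernel_fiber F u \<in> kernel_fibers \<phi> \<F>"
proof -
  have "v \<in> (\<lambda>m. u + m) ` ker \<phi>" if "\<phi> v = \<phi> u" for v
    using that by (intro image_eqI[of _ _ "v - u"]) (auto simp: ker_def diff)
  then have "kernel_fiber F u = F \<inter> (\<lambda>m. u + m) ` ker \<phi>"
    by (auto simp: ker_def add)
  then show ?thesis using assms unfolding kernel_fibers_def by blast
qed

lemmas kernelD =
  kernel[unfolded kernel_groebner_basis_def groebner_basis_iff, rule_format,
    OF kernel_fiber_in_kernel_fibers]

lemma projectedD:
  assumes "F \<in> \<F>"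
  shows "weakly_connected (\<phi> ` F) (image_arcs F)"
    and "\<And>x y. x \<in> \<phi> ` F \<Longrightarrow> y \<in> \<phi> ` F \<Longrightarrow> recurrent (image_arcs F) x \<Longrightarrow>
      recurrent (image_arcs F) y \<Longrightarrow> (x, y) \<in> (image_arcs F)\<^sup>*"
    and "\<And>x w. x \<in> \<phi> ` F \<Longrightarrow> recurrent (image_arcs F) x \<Longrightarrow> w \<in> \<phi> ` F \<Longrightarrow> geq' w x"
  using projected assms unfolding projected_fiber_groebner_basis_def groebner_basis_iff by auto

lemma kernel_arcs_subset_arcs: "kernel_arcs F u \<subseteq> arcs F"
  by (rule fiber_arcs_mono) auto

lemma kernel_path_imp_path: "(v, w) \<in> (kernel_arcs F u)\<^sup>* \<Longrightarrow> (v, w) \<in> (arcs F)\<^sup>*"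
  using rtrancl_mono[OF kernel_arcs_subset_arcs] by blast

lemma same_image_connected:
  assumes "F \<in> \<F>" "v \<in> F" "w \<in> F" "\<phi> v = \<phi> w"
  shows "(v, w) \<in> (arcs F \<union> (arcs F)\<inverse>)\<^sup>*"
proof -
  have "(v, w) \<in> (kernel_arcs F w \<union> (kernel_arcs F w)\<inverse>)\<^sup>*"
    using kernelD[OF assms(1), of w] assms(2-4) unfolding weakly_connected_def by auto
  moreover have "kernel_arcs F w \<union> (kernel_arcs F w)\<inverse> \<subseteq> arcs F \<union> (arcs F)\<inverse>"
    using kernel_arcs_subset_arcs by blast
  ultimately show ?thesis using rtrancl_mono by blast
qed

text \<open>The lift property, read off in graph terms: the kernel move is only a comparison within the
  kernel fibre, not yet a path.\<close>

lemma image_arc_lifts: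
  assumes F: "F \<in> \<F>" and v: "v \<in> F" and arc: "(\<phi> v, w) \<in> image_arcs F" and ne: "\<phi> v \<noteq> w"
  obtains y z where "y \<in> kernel_fiber F v" "geq v y" "(y, z) \<in> arcs F" "z \<in> F" "\<phi> z = w"
proof -
  obtain v' where v': "v' \<in> F" "w = \<phi> v'" using arc unfolding fiber_arcs_def by auto
  have "geq v v'" using arc compatibleD[OF F v v'(1)] ne v' by (auto simp: fiber_arcs_def)
  moreover have "\<phi> (v - v') \<in> pm G"
    using arc unfolding v'(2) by (auto simp: fiber_arcs_def diff intro: pm_diff_swap)
  ultimately obtain m\<^sub>0 m where m: "m\<^sub>0 \<in> ker \<phi>" "m \<in> pm M\<^sub>1" "v + m\<^sub>0 \<in> F" "v + m\<^sub>0 + m \<in> F"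
    "geq v (v + m\<^sub>0)" "geq (v + m\<^sub>0) (v + m\<^sub>0 + m)" "\<phi> (v + m\<^sub>0 + m) = \<phi> v'"
    using lift F v v'(1) unfolding is_lift_def by blast
  show thesis
  proof (rule that)
    show "v + m\<^sub>0 \<in> kernel_fiber F v" using m by (simp add: add ker_def)
    show "(v + m\<^sub>0, v + m\<^sub>0 + m) \<in> arcs F" using m by (auto simp: fiber_arcs_def pm_def)
  qed (use m v' in auto)
qed

section \<open>Weak connectedness\<close>

lemma image_arc_connected:
  assumes F: "F \<in> \<F>" and v: "v \<in> F" and w: "w \<in> F" and arc: "(\<phi> v, \<phi> w) \<in> image_arcs F"
  shows "(v, w) \<in> (arcs F \<union> (arcs F)\<inverse>)\<^sup>*"
proof (cases "\<phi> v = \<phi> w")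
  case True
  then show ?thesis using same_image_connected F v w by blast
next
  case False
  then obtain y z where yz: "y \<in> kernel_fiber F v" "(y, z) \<in> arcs F" "z \<in> F" "\<phi> z = \<phi> w"
    using image_arc_lifts[OF F v arc] by blast
  have "(v, y) \<in> (arcs F \<union> (arcs F)\<inverse>)\<^sup>*" using same_image_connected[OF F v] yz(1) by simp
  also have "(y, z) \<in> (arcs F \<union> (arcs F)\<inverse>)\<^sup>*" using yz(2) by blast
  also have "(z, w) \<in> (arcs F \<union> (arcs F)\<inverse>)\<^sup>*" using same_image_connected[OF F yz(3) w yz(4)] .
  finally show ?thesis .
qed

lemma weakly_connected_arcs:
  assumes F: "F \<in> \<F>"
  shows "weakly_connected F (arcs F)"
  unfolding weakly_connected_def
proof (intro ballI)
  let ?U = "arcs F \<union> (arcs F)\<inverse>"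
  have sym: "(b, a) \<in> ?U\<^sup>*" if "(a, b) \<in> ?U\<^sup>*" for a b
    using that by (rule symD[OF sym_rtrancl[OF sym_Un_converse]])
  fix u v assume u: "u \<in> F" and v: "v \<in> F"
  have "(\<phi> u, \<phi> v) \<in> (image_arcs F \<union> (image_arcs F)\<inverse>)\<^sup>*"
    using projectedD(1)[OF F] u v unfolding weakly_connected_def by simp
  then have "\<forall>b\<in>F. \<phi> b = \<phi> v \<longrightarrow> (u, b) \<in> ?U\<^sup>*"
  proof (induction rule: rtrancl_induct)
    case base
    show ?case using same_image_connected[OF F u] by auto
  next
    case (step p q)
    have "p \<in> \<phi> ` F" using step.hyps(2) by (auto simp: fiber_arcs_def)
    then obtain a where a: "a \<in> F" "\<phi> a = p" by blast
    show ?case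
    proof (intro ballI impI)
      fix b assume b: "b \<in> F" "\<phi> b = q"
      from step.hyps(2) have "(p, q) \<in> image_arcs F \<or> (q, p) \<in> image_arcs F" by simp
      then have "(a, b) \<in> ?U\<^sup>*"
      proof
        assume "(p, q) \<in> image_arcs F"
        then show ?thesis using image_arc_connected[OF F a(1) b(1)] a(2) b(2) by simp
      next
        assume "(q, p) \<in> image_arcs F"
        then have "(b, a) \<in> ?U\<^sup>*"
          using image_arc_connected[OF F b(1) a(1)] a(2) b(2) by simp
        then show ?thesis by (rule sym)
      qed
      moreover have "(u, a) \<in> ?U\<^sup>*" using step.IH a by blast
      ultimately show "(u, b) \<in> ?U\<^sup>*" by (rule rtrancl_trans[rotated])
    qed
  qed
  then show "(u, v) \<in> ?U\<^sup>*" using v by blast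
qed

section \<open>Recurrent vertices\<close>

lemma recurrent_in_kernel_fiber:
  assumes "recurrent (arcs F) x"
  shows "recurrent (kernel_arcs F u) x"
  using assms kernel_path_imp_path unfolding recurrent_iff[OF geq] by blast

lemma recurrent_minimum_of_kernel_fiber:
  assumes F: "F \<in> \<F>" and x: "x \<in> F" "recurrent (arcs F) x" and w: "w \<in> kernel_fiber F x"
  shows "geq w x"
  using kernelD[OF F, of x] recurrent_in_kernel_fiber[OF x(2)] x(1) w by blast

text \<open>This is where a comparison becomes a path: an element of the kernel fibre below a minimum is
  itself a minimum, hence recurrent, and the kernel Groebner basis joins the two.\<close>

lemma reaches_smaller_in_kernel_fiber:
  assumes F: "F \<in> \<F>" and x: "x \<in> F" "recurrent (arcs F) x"
    and y: "y \<in> kernel_fiber F x" "geq x y"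
  shows "(x, y) \<in> (arcs F)\<^sup>*"
proof -
  have "geq w y" if "w \<in> kernel_fiber F x" for w
    using additive_preorder_trans[OF geq recurrent_minimum_of_kernel_fiber[OF F x that] y(2)] .
  then have "recurrent (kernel_arcs F x) y" using minimum_imp_recurrent[OF geq y(1)] by blast
  then have "(x, y) \<in> (kernel_arcs F x)\<^sup>*"
    using kernelD[OF F, of x] recurrent_in_kernel_fiber[OF x(2)] x(1) y(1) by blast
  then show ?thesis by (rule kernel_path_imp_path)
qed

lemma image_path_lifts:
  assumes F: "F \<in> \<F>" and x: "x \<in> F" "recurrent (arcs F) x"
    and path: "(\<phi> x, w) \<in> (image_arcs F)\<^sup>*"
  shows "\<exists>y\<in>F. (x, y) \<in> (arcs F)\<^sup>* \<and> \<phi> y = w"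
  using path
proof (induction rule: rtrancl_induct)
  case base
  show ?case using x by blast
next
  case (step p q)
  then obtain v where v: "v \<in> F" "(x, v) \<in> (arcs F)\<^sup>*" "\<phi> v = p" by blast
  have rec: "recurrent (arcs F) v" using recurrent_reachable[OF x(2) v(2)] .
  show ?case
  proof (cases "p = q")
    case True
    then show ?thesis using v by blast
  next
    case False
    then obtain y z where yz: "y \<in> kernel_fiber F v" "geq v y" "(y, z) \<in> arcs F" "z \<in> F" "\<phi> z = q"
      using image_arc_lifts[OF F v(1)] step.hyps(2) v(3) by blast
    have "(v, y) \<in> (arcs F)\<^sup>*" using reaches_smaller_in_kernel_fiber[OF F v(1) rec yz(1,2)] .
    then have "(x, z) \<in> (arcs F)\<^sup>*"
      using v(2) yz(3) by (meson rtrancl_trans rtrancl.rtrancl_into_rtrancl)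
    then show ?thesis using yz by blast
  qed
qed

lemma recurrent_image:
  assumes F: "F \<in> \<F>" and x: "x \<in> F" "recurrent (arcs F) x"
  shows "recurrent (image_arcs F) (\<phi> x)"
  unfolding recurrent_iff[OF geq']
proof (intro allI impI)
  fix w assume "(\<phi> x, w) \<in> (image_arcs F)\<^sup>*"
  then obtain y where y: "y \<in> F" "(x, y) \<in> (arcs F)\<^sup>*" "\<phi> y = w"
    using image_path_lifts[OF F x] by blast
  have "geq y x" using x(2) y(2) unfolding recurrent_iff[OF geq] by blast
  then show "geq' w (\<phi> x)"
    using compatibleD[OF F y(1) x(1)] y(3)
      additive_preorder_refl[OF geq']
    by (cases "w = \<phi> x") auto
qed

lemma recurrent_minimum:
  assumes F: "F \<in> \<F>" and x: "x \<in> F" "recurrent (arcs F) x" and w: "w \<in> F"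
  shows "geq w x"
proof (cases "\<phi> w = \<phi> x")
  case True
  then show ?thesis using recurrent_minimum_of_kernel_fiber[OF F x] w by blast
next
  case False
  have "geq' (\<phi> w) (\<phi> x)" using projectedD(3)[OF F] recurrent_image[OF F x] x(1) w by blast
  then show ?thesis using compatibleD[OF F w x(1) False] by blast
qed

lemma recurrent_reach_each_other:
  assumes F: "F \<in> \<F>" and x: "x \<in> F" "recurrent (arcs F) x"
    and z: "z \<in> F" "recurrent (arcs F) z"
  shows "(x, z) \<in> (arcs F)\<^sup>*"
proof -
  have "(\<phi> x, \<phi> z) \<in> (image_arcs F)\<^sup>*"
    using projectedD(2)[OF F] recurrent_image[OF F] x z by blast
  then obtain y where y: "y \<in> F" "(x, y) \<in> (arcs F)\<^sup>*" "\<phi> y = \<phi> z"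
    using image_path_lifts[OF F x] by blast
  have rec: "recurrent (arcs F) y" using recurrent_reachable[OF x(2) y(2)] .
  have "(y, z) \<in> (arcs F)\<^sup>*"
    using reaches_smaller_in_kernel_fiber[OF F y(1) rec] recurrent_minimum[OF F z y(1)] z(1) y(3)
    by simp
  then show ?thesis using y(2) by (meson rtrancl_trans)
qed

lemma groebner_basis_union: "groebner_basis geq \<F> (M\<^sub>0 \<union> M\<^sub>1)"
  unfolding groebner_basis_iff
  using weakly_connected_arcs recurrent_reach_each_other recurrent_minimum by blast

end

theorem theorem16:
  fixes \<F> :: "(int ^ 'n) set set"
    and \<phi> :: "int ^ 'n \<Rightarrow> int ^ 't"
    and geq :: "int ^ 'n \<Rightarrow> int ^ 'n \<Rightarrow> bool"
    and geq' :: "int ^ 't \<Rightarrow> int ^ 't \<Rightarrow> bool"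
    and G :: "(int ^ 't) set"
    and M\<^sub>0 M\<^sub>1 :: "(int ^ 'n) set"
  assumes "module_hom (*s) (*s) \<phi>"
    and "additive_preorder geq"
    and "additive_preorder geq'"
    and "compatible_preorders geq geq' \<phi> \<F>"
    and "projected_fiber_groebner_basis geq' \<phi> \<F> G"
    and "is_lift \<F> \<phi> geq G M\<^sub>1"
    and "kernel_groebner_basis geq \<phi> \<F> M\<^sub>0"
  shows "groebner_basis geq \<F> (M\<^sub>0 \<union> M\<^sub>1)"
proof -
  interpret compatible_lift \<phi> \<F> geq geq' G M\<^sub>0 M\<^sub>1
    using assms by unfold_locales (auto dest: module_hom.add)
  show ?thesis by (rule groebner_basis_union)
qed

end
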